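(* Let $n\ge1$ and suppose that $f:\mathbb{R}^n\to\mathbb{R}^n$ is a $C^1$ map with nilpotent fixed points. If $f$ is globally linearizable, then $f$ has a unique fixed point.
   Context: "$f$ has nilpotent fixed points" means that the Jacobian matrix $J(f)(p)$ is nilpotent at each fixed point $p$ of $f$. "$f$ is globally linearizable" means that there is an invertible (bijective, not necessarily continuous) map $\sigma:\mathbb{R}^n\to\mathbb{R}^n$ such that $\sigma^{-1}\circ f\circ\sigma$ is a linear map of $\mathbb{R}^n$ to itself. *)

theory Defs
  imports "HOL-Analysis.Analysis"
begin

definition C1_map :: "(real ^ 'n \<Rightarrow> real ^ 'm) \<Rightarrow> bool" where
  "C1_map f \<longleftrightarrow> f differentiable_on UNIV \<and> continuous_on UNIV (\<lambda>x. jacobian f (at x))"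

(* On the type real ^ 'n ^ 'n the library's multiplication "*", and hence the power "A ^ k",
   is componentwise; matrix powers have to be built from the matrix product "**". *)
primrec matrix_power :: "real ^ 'n ^ 'n \<Rightarrow> nat \<Rightarrow> real ^ 'n ^ 'n" where
  "matrix_power A 0 = mat 1"
| "matrix_power A (Suc k) = A ** matrix_power A k"

definition nilpotent_matrix :: "real ^ 'n ^ 'n \<Rightarrow> bool" where
  "nilpotent_matrix A \<longleftrightarrow> (\<exists>k. matrix_power A k = 0)"

definition nilpotent_fixed_points :: "(real ^ 'n \<Rightarrow> real ^ 'n) \<Rightarrow> bool" where
  "nilpotent_fixed_points f \<longleftrightarrow> (\<forall>p. f p = p \<longrightarrow> nilpotent_matrix (jacobian f (at p)))"

definition globally_linearizable :: "(real ^ 'n \<Rightarrow> real ^ 'n) \<Rightarrow> bool" where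
  "globally_linearizable f \<longleftrightarrow>
     (\<exists>\<sigma> :: real ^ 'n \<Rightarrow> real ^ 'n. bij \<sigma> \<and> linear (inv \<sigma> \<circ> f \<circ> \<sigma>))"

end

theory Submission
  imports Defs
begin

text \<open>
  A nilpotent matrix does not have the eigenvalue \<open>1\<close>, so \<open>f - id\<close> has an injective derivative
  at every fixed point of \<open>f\<close>, and hence every fixed point is isolated. As the fixed point set is
  also closed, it has no limit points at all and is therefore countable
  (\<open>countable_fixed_points_if_nilpotent\<close>). A linearization \<open>\<sigma>\<close>, on the other hand, maps the
  eigenspace of a linear map for the eigenvalue \<open>1\<close> bijectively onto the fixed point set. This
  eigenspace contains \<open>0\<close>, and it is uncountable as soon as it contains another vector. As every
  bijection, continuous or not, preserves countability, the eigenspace is \<open>{0}\<close>, and \<open>\<sigma> 0\<close> is the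
  unique fixed point.
\<close>

lemma matrix_power_eigenvector_1:
  assumes "A *v v = v"
  shows "matrix_power A k *v v = v"
  using assms by (induction k) (simp_all flip: matrix_vector_mul_assoc)

lemma nilpotent_matrix_fixes_only_0:
  assumes "nilpotent_matrix A" and "A *v v = v"
  shows "v = 0"
  using assms matrix_power_eigenvector_1 unfolding nilpotent_matrix_def
  by (metis matrix_vector_mult_0)

text \<open>
  If fixed points of \<open>f\<close> accumulated at \<open>p\<close>, then \<open>f - id\<close> would vanish at points \<open>y\<close> arbitrarily
  close to \<open>p\<close>. There it equals \<open>D (y - p) - (y - p)\<close> up to an error of smaller order, although
  the norm of this linear term is at least a positive multiple of \<open>norm (y - p)\<close>.
\<close>

lemma fixed_point_not_islimpt:
  fixes f :: "'a::euclidean_space \<Rightarrow> 'a"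
  assumes deriv: "(f has_derivative D) (at p)" and "f p = p"
    and no_eigenvalue_1: "\<And>v. D v = v \<Longrightarrow> v = 0"
  shows "\<not> p islimpt {x. f x = x}"
proof -
  have lin: "linear (\<lambda>v. D v - v)"
    using has_derivative_linear[OF deriv] by (intro linear_compose_sub linear_id[unfolded id_def])
  moreover have "inj (\<lambda>v. D v - v)"
    unfolding linear_injective_0[OF lin] using no_eigenvalue_1 by simp
  ultimately obtain B where "B > 0" and B: "\<And>v. B * norm v \<le> norm (D v - v)"
    using linear_inj_bounded_below_pos by blast
  have "\<exists>d>0. \<forall>y. norm (y - p) < d \<longrightarrow> norm (f y - f p - D (y - p)) \<le> B / 2 * norm (y - p)"
    using deriv \<open>B > 0\<close> unfolding has_derivative_at_alt by (meson half_gt_zero)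
  then obtain d where "d > 0"
    and d: "\<And>y. norm (y - p) < d \<Longrightarrow> norm (f y - f p - D (y - p)) \<le> B / 2 * norm (y - p)"
    by blast
  have "y = p" if "f y = y" and "dist y p < d" for y
  proof -
    have "B * norm (y - p) \<le> norm (D (y - p) - (y - p))"
      by (rule B)
    also have "\<dots> = norm (f y - f p - D (y - p))"
      using that \<open>f p = p\<close> by (simp add: norm_minus_commute)
    also have "\<dots> \<le> B / 2 * norm (y - p)"
      using d[of y] that by (simp only: dist_norm)
    finally have "B * norm (y - p) \<le> 0"
      by simp
    with \<open>B > 0\<close> show ?thesis
      by (simp add: mult_le_0_iff)
  qed
  with \<open>d > 0\<close> show ?thesis
    unfolding islimpt_approachable by blast
qed

lemma countable_fixed_points_if_nilpotent:
  fixes f :: "real ^ 'n \<Rightarrow> real ^ 'n"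
  assumes diff: "f differentiable_on UNIV" and nil: "nilpotent_fixed_points f"
  shows "countable {x. f x = x}"
proof -
  let ?F = "{x. f x = x}"
  have "continuous_on UNIV f"
    using diff by (rule differentiable_imp_continuous_on)
  then have "closed ?F"
    by (intro closed_Collect_eq continuous_on_id)
  have "\<not> p islimpt ?F" for p
  proof
    assume lim: "p islimpt ?F"
    with \<open>closed ?F\<close> have "f p = p"
      unfolding closed_limpt by blast
    have "(f has_derivative (\<lambda>h. jacobian f (at p) *v h)) (at p)"
      using diff unfolding differentiable_on_def jacobian_works by simp
    moreover have "v = 0" if "jacobian f (at p) *v v = v" for v
      using nil \<open>f p = p\<close> that nilpotent_matrix_fixes_only_0
      unfolding nilpotent_fixed_points_def by blast
    ultimately show False
      using fixed_point_not_islimpt \<open>f p = p\<close> lim by blast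
  qed
  then have "?F sparse_in UNIV"
    unfolding sparse_in_def by blast
  from sparse_imp_countable[OF open_UNIV this] show ?thesis
    by simp
qed

lemma linear_fixed_point_eq_0_if_countable:
  fixes L :: "'a::real_normed_vector \<Rightarrow> 'a"
  assumes "linear L" and "countable {v. L v = v}" and "L v = v"
  shows "v = 0"
proof -
  have "convex {v. L v = v}"
    using \<open>linear L\<close> by (simp add: convex_def linear_add linear_scale)
  moreover have "0 \<in> {v. L v = v}"
    using \<open>linear L\<close> by (simp add: linear_0)
  ultimately show ?thesis
    using uncountable_convex[of _ 0 v] assms by blast
qed

theorem theorem10p1:
  fixes f :: "real ^ 'n \<Rightarrow> real ^ 'n"
  assumes "C1_map f"
    and "nilpotent_fixed_points f"
    and "globally_linearizable f"
  shows "\<exists>!p. f p = p"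
proof -
  obtain \<sigma> :: "real ^ 'n \<Rightarrow> real ^ 'n" where "bij \<sigma>" and lin: "linear (inv \<sigma> \<circ> f \<circ> \<sigma>)"
    using assms(3) unfolding globally_linearizable_def by blast
  define L where "L = inv \<sigma> \<circ> f \<circ> \<sigma>"
  have conj: "f (\<sigma> v) = \<sigma> v \<longleftrightarrow> L v = v" for v
    using \<open>bij \<sigma>\<close> unfolding L_def comp_def by (metis bij_inv_eq_iff)
  have "countable {x. f x = x}"
    using assms(1,2) countable_fixed_points_if_nilpotent unfolding C1_map_def by blast
  moreover have "\<sigma> ` {v. L v = v} \<subseteq> {x. f x = x}"
    using conj by auto
  ultimately have "countable (\<sigma> ` {v. L v = v})"
    by (rule countable_subset[rotated])
  then have "countable {v. L v = v}"
    using bij_is_inj[OF \<open>bij \<sigma>\<close>] by (metis countable_image_inj_on inj_on_subset subset_UNIV)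
  then have only_0: "L v = v \<longleftrightarrow> v = 0" for v
    using lin linear_fixed_point_eq_0_if_countable[of L v] linear_0[of L] unfolding L_def by auto
  show ?thesis
  proof (rule ex1I)
    show "f (\<sigma> 0) = \<sigma> 0"
      using conj only_0 by simp
    show "p = \<sigma> 0" if "f p = p" for p
      using that conj only_0 \<open>bij \<sigma>\<close> by (metis bij_pointE)
  qed
qed

end
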